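(* Let $\alpha,\beta,\tilde\alpha,\tilde\beta,b,p,q>0$ with $p\le\tilde\alpha$. Define, for $s>0$, $$f^{DSD}(s)=\mathcal{K}_{DSD}\;s^{-q-1}\,{}_2F_1\!\left(q+\alpha,\;q+p;\;q+\tilde\alpha;\;-\frac{b\tilde\beta}{s\beta}\right),\qquad \mathcal{K}_{DSD}=\left(\frac{b\tilde\beta}{\beta}\right)^{q}\frac{1}{B(p,q)}\,\frac{\Gamma(\tilde\alpha)}{\Gamma(q+\tilde\alpha)}\,\frac{\Gamma(q+\alpha)}{\Gamma(\alpha)}.$$ Then $f^{DSD}$ is a probability density on $(0,\infty)$ (it is strictly positive and integrates to $1$), and it solves the integral equation $$\int_0^{\infty} g_{\tilde\alpha,\tilde\beta/s}(v)\,f^{DSD}(s)\,\mathrm{d}s=f_{\mathcal V}(v)\qquad\text{for all } v>0,$$ where $g_{a,r}$ is the density of $\mathrm{Gamma}(a,r)$ and $f_{\mathcal V}$ is the density of the ${}_2\mathcal{F}_0(\alpha,\beta/b,p,q)$ distribution.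
   Context: $\mathrm{Gamma}(a,r)$ denotes the gamma distribution with shape $a>0$ and rate $r>0$, with density $g_{a,r}(x)=\frac{r^a}{\Gamma(a)}x^{a-1}e^{-rx}$ on $(0,\infty)$. $\mathrm{B2}(b,p,q)$ is the distribution on $(0,\infty)$ with density $\frac{b^q}{B(p,q)}\,s^{-q-1}\left(1+\frac{b}{s}\right)^{-p-q}$, $B(\cdot,\cdot)$ being the Beta function. The ${}_2\mathcal{F}_0(\alpha,\beta/b,p,q)$ distribution is the marginal law of $X$ when $X\mid Y=y\sim\mathrm{Gamma}(\alpha,\beta/y)$ and $Y\sim\mathrm{B2}(b,p,q)$, i.e. $f_{\mathcal V}(v)=\int_0^\infty g_{\alpha,\beta/y}(v)\,\frac{b^q}{B(p,q)}y^{-q-1}(1+b/y)^{-p-q}\,\mathrm{d}y$. ${}_2F_1(a,c;d;x)$ is the Gauss hypergeometric function (for $x<0$ its analytic continuation/principal branch). *)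

theory Defs
  imports "HOL-Analysis.Analysis"
begin

definition gamma_dens :: "real \<Rightarrow> real \<Rightarrow> real \<Rightarrow> real" where
  "gamma_dens a r x = (if x > 0 then r powr a / Gamma a * x powr (a - 1) * exp (- (r * x)) else 0)"

definition b2_dens :: "real \<Rightarrow> real \<Rightarrow> real \<Rightarrow> real \<Rightarrow> real" where
  "b2_dens b p q s = (if s > 0 then b powr q / Beta p q * s powr (- q - 1) * (1 + b / s) powr (- p - q) else 0)"

definition fV :: "real \<Rightarrow> real \<Rightarrow> real \<Rightarrow> real \<Rightarrow> real \<Rightarrow> real \<Rightarrow> real" where
  "fV alpha beta b p q v = integral {0<..} (\<lambda>y. gamma_dens alpha (beta / y) v * b2_dens b p q y)"

definition hyp2F1_series :: "real \<Rightarrow> real \<Rightarrow> real \<Rightarrow> real \<Rightarrow> real" where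
  "hyp2F1_series a c d x =
     (\<Sum>n. pochhammer a n * pochhammer c n / (pochhammer d n * fact n) * x ^ n)"

text \<open>Gauss hypergeometric function 2F1(a,c;d;x): the series for |x| < 1, and for x \<le> -1 its
  analytic continuation (principal branch) given by the Pfaff transformation
  2F1(a,c;d;x) = (1-x)^(-a) 2F1(a,d-c;d;x/(x-1)), where x/(x-1) \<in> [1/2,1).
  Values for x \<ge> 1 are irrelevant here and set to 0.\<close>
definition hyp2F1 :: "real \<Rightarrow> real \<Rightarrow> real \<Rightarrow> real \<Rightarrow> real" where
  "hyp2F1 a c d x =
     (if \<bar>x\<bar> < 1 then hyp2F1_series a c d x
      else if x < 0 then (1 - x) powr (- a) * hyp2F1_series a (d - c) d (x / (x - 1))
      else 0)"

definition K_DSD :: "real \<Rightarrow> real \<Rightarrow> real \<Rightarrow> real \<Rightarrow> real \<Rightarrow> real \<Rightarrow> real \<Rightarrow> real" where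
  "K_DSD alpha beta alpha' beta' b p q =
     (b * beta' / beta) powr q * (1 / Beta p q) * (Gamma alpha' / Gamma (q + alpha'))
       * (Gamma (q + alpha) / Gamma alpha)"

definition f_DSD :: "real \<Rightarrow> real \<Rightarrow> real \<Rightarrow> real \<Rightarrow> real \<Rightarrow> real \<Rightarrow> real \<Rightarrow> real \<Rightarrow> real" where
  "f_DSD alpha beta alpha' beta' b p q s =
     K_DSD alpha beta alpha' beta' b p q * s powr (- q - 1)
       * hyp2F1 (q + alpha) (q + p) (q + alpha') (- (b * beta') / (s * beta))"

end

theory Submission
  imports Defs
begin

text \<open>
  Write \<open>A = q + alpha\<close>, \<open>C = q + p\<close>, \<open>D = q + alpha'\<close> and \<open>r = 1/s\<close>. Euler's integral holds on both
  branches of \<^const>\<open>hyp2F1\<close> and shows that \<open>r powr (D - 1) * hyp2F1 A C D (-c r)\<close> is, up to a factor, the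
  convolution of \<open>w powr (C - 1) * (1 + c w) powr (-A)\<close> with a power. Its Laplace transform is
  therefore a power times a Tricomi integral, and Kummer's symmetry of that integral in \<open>A\<close> and \<open>C\<close>
  turns it into the integral defining \<^const>\<open>fV\<close>. The total mass is a Mellin transform, obtained by
  integrating the Laplace transform against a power. All integrands are nonnegative, so
  Tonelli's theorem suffices throughout; the boundary case \<open>p = alpha'\<close>, where Euler's integral degenerates,
  is the binomial \<open>hyp2F1 A C C (-z) = (1 + z) powr (-A)\<close>.
\<close>

subsection \<open>Lebesgue integrals over the half-line\<close>

text \<open>This is Tonelli on a product of two Borel sets. The inner integrals \<open>g\<close> and
  \<open>h\<close> are needed only on the sets, so formulas valid only for positive arguments can be
  supplied directly.\<close>

lemma nn_set_integral_swap:
  fixes f :: "real \<Rightarrow> real \<Rightarrow> ennreal"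
  assumes f [measurable]: "case_prod f \<in> borel_measurable (borel \<Otimes>\<^sub>M borel)"
    and [measurable]: "S \<in> sets borel" "T \<in> sets borel"
    and g: "\<And>x. x \<in> S \<Longrightarrow> (\<integral>\<^sup>+y\<in>T. f x y \<partial>lborel) = g x"
    and h: "\<And>y. y \<in> T \<Longrightarrow> (\<integral>\<^sup>+x\<in>S. f x y \<partial>lborel) = h y"
  shows "(\<integral>\<^sup>+x\<in>S. g x \<partial>lborel) = (\<integral>\<^sup>+y\<in>T. h y \<partial>lborel)"
proof -
  have "(\<integral>\<^sup>+x\<in>S. g x \<partial>lborel)
      = (\<integral>\<^sup>+x. \<integral>\<^sup>+y. f x y * indicator T y * indicator S x \<partial>lborel \<partial>lborel)"
    by (intro nn_integral_cong) (auto simp: g split: split_indicator)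
  also have "\<dots> = (\<integral>\<^sup>+y. \<integral>\<^sup>+x. f x y * indicator T y * indicator S x \<partial>lborel \<partial>lborel)"
    by (intro lborel_pair.Fubini'[symmetric]) measurable
  also have "\<dots> = (\<integral>\<^sup>+y\<in>T. h y \<partial>lborel)"
    by (intro nn_integral_cong) (auto simp flip: h simp: mult.assoc split: split_indicator)
  finally show ?thesis .
qed

lemma nn_set_integral_cmult:
  fixes f :: "real \<Rightarrow> ennreal"
  assumes [measurable]: "f \<in> borel_measurable borel" "S \<in> sets borel"
  shows "(\<integral>\<^sup>+x\<in>S. c * f x \<partial>lborel) = c * (\<integral>\<^sup>+x\<in>S. f x \<partial>lborel)"
  by (subst nn_integral_cmult [symmetric]) (auto simp: mult.assoc)

lemma nn_set_integral_cong:
  assumes "\<And>x. x \<in> S \<Longrightarrow> f x = g x"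
  shows "(\<integral>\<^sup>+x\<in>S. f x \<partial>M) = (\<integral>\<^sup>+x\<in>S. g x \<partial>M)"
  using assms by (intro nn_integral_cong) (auto split: split_indicator)

text \<open>The bridge from nonnegative Lebesgue integrals to the gauge integrals of the theorem:
  substitute \<open>s = 1 / r\<close>, with Jacobian \<open>1 / r\<^sup>2\<close>. Nonnegativity
  upgrades integrability to absolute integrability, which the change of variables requires.\<close>

lemma has_integral_reciprocal_substitution:
  fixes f :: "real \<Rightarrow> real"
  assumes [measurable]: "f \<in> borel_measurable borel"
    and nonneg: "\<And>s. s > 0 \<Longrightarrow> f s \<ge> 0" and "I \<ge> 0"
    and I: "(\<integral>\<^sup>+r\<in>{0<..}. ennreal (f (1 / r) / r\<^sup>2) \<partial>lborel) = ennreal I"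
  shows "(f has_integral I) {0<..}"
proof -
  let ?F = "\<lambda>r. f (1 / r) / r\<^sup>2"
  have "((\<lambda>r. if r \<in> {0<..} then ?F r else 0) has_integral I) UNIV"
  proof (rule nn_integral_has_integral)
    have "(\<integral>\<^sup>+r. ennreal (if r \<in> {0<..} then ?F r else 0) \<partial>lborel) = (\<integral>\<^sup>+r\<in>{0<..}. ennreal (?F r) \<partial>lborel)"
      by (intro nn_integral_cong) (auto split: split_indicator)
    then show "(\<integral>\<^sup>+r. ennreal (if r \<in> {0<..} then ?F r else 0) \<partial>lborel) = ennreal I"
      using I by simp
  qed (use nonneg \<open>I \<ge> 0\<close> in auto)
  then have F: "(?F has_integral I) {0<..}"
    by (simp only: has_integral_restrict_UNIV)
  then have "?F absolutely_integrable_on {0<..}"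
    using nonneg by (intro nonnegative_absolutely_integrable_1) (auto simp: has_integral_integrable_integral)
  then have "(\<lambda>r. \<bar>- (1 / r\<^sup>2)\<bar> * f (1 / r)) absolutely_integrable_on {0<..}
      \<and> integral {0<..} (\<lambda>r. \<bar>- (1 / r\<^sup>2)\<bar> * f (1 / r)) = I"
    using F by (simp add: has_integral_integrable_integral)
  moreover have "((\<lambda>r. 1 / r) has_field_derivative - (1 / r\<^sup>2)) (at r within {0<..})" if "r \<in> {0<..}" for r :: real
    using that by (auto intro!: derivative_eq_intros simp: power2_eq_square)
  moreover have "inj_on (\<lambda>r::real. 1 / r) {0<..}"
    by (auto simp: inj_on_def)
  moreover have "(\<lambda>r::real. 1 / r) ` {0<..} = {0<..}"
  proof (intro equalityI subsetI)
    fix s :: real assume "s \<in> {0<..}"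
    then show "s \<in> (\<lambda>r. 1 / r) ` {0<..}" by (intro image_eqI[of _ _ "1 / s"]) auto
  qed auto
  ultimately have "f absolutely_integrable_on {0<..} \<and> integral {0<..} f = I"
    using has_absolute_integral_change_of_variables_1'[of "{0<..}" "\<lambda>r. 1 / r" "\<lambda>r. - (1 / r\<^sup>2)" f I] by auto
  then show ?thesis
    by (simp add: has_integral_integrable_integral absolutely_integrable_on_def)
qed

text \<open>Both \<open>b2_dens\<close> and \<open>f_DSD\<close> carry the factor
  \<open>s powr (- q - 1)\<close>; under \<open>s = 1 / r\<close> the Jacobian turns it into the
  Mellin kernel.\<close>

lemma powr_reciprocal:
  fixes r q :: real
  assumes "r > 0"
  shows "(1 / r) powr (- q - 1) / r\<^sup>2 = r powr (q - 1)"
proof -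
  have "(1 / r) powr (- q - 1) = r powr (q + 1)"
    using assms powr_minus_divide[of r "- q - 1"] by (simp add: powr_divide add.commute)
  then have "(1 / r) powr (- q - 1) / r\<^sup>2 = r powr (q + 1) / r powr 2"
    using assms by simp
  also have "\<dots> = r powr (q + 1 - 2)"
    by (rule powr_diff[symmetric])
  finally show ?thesis by simp
qed

subsection \<open>Gamma and Beta integrals\<close>

lemma Gamma_real_nonzero [simp]: "x > 0 \<Longrightarrow> Gamma (x :: real) \<noteq> 0"
  using Gamma_real_pos[of x] by linarith

lemma ennreal_mult_assoc:
  "x \<ge> 0 \<Longrightarrow> y \<ge> 0 \<Longrightarrow> ennreal x * (ennreal y * J) = ennreal (x * y) * J"
  by (simp add: ennreal_mult mult.assoc)

text \<open>The scaling \<open>t = k * x\<close> in Euler's integral for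
  \<open>Gamma a\<close>.\<close>

lemma nn_integral_Gamma:
  fixes a k :: real
  assumes a: "a > 0" and k: "k > 0"
  shows "(\<integral>\<^sup>+x\<in>{0<..}. ennreal (x powr (a - 1) * exp (- (k * x))) \<partial>lborel)
       = ennreal (Gamma a * k powr (- a))"
proof -
  have "ennreal (Gamma a) = (\<integral>\<^sup>+t. ennreal (indicator {0..} t * t powr (a - 1) / exp t) \<partial>lborel)"
    by (rule Gamma_conv_nn_integral_real[OF a])
  also have "\<dots> = ennreal k * (\<integral>\<^sup>+t. ennreal (indicator {0..} (0 + k * t) * (0 + k * t) powr (a - 1)
                                    / exp (0 + k * t)) \<partial>lborel)"
    using k by (subst nn_integral_real_affine[where c = k and t = 0]) auto
  also have "\<dots> = ennreal k * (\<integral>\<^sup>+x\<in>{0<..}. ennreal (k powr (a - 1)) *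
                               ennreal (x powr (a - 1) * exp (- (k * x))) \<partial>lborel)"
    using k by (intro arg_cong[where f = "\<lambda>x. ennreal k * x"] nn_integral_cong)
      (auto simp: powr_mult exp_minus field_simps zero_le_mult_iff simp flip: ennreal_mult split: split_indicator)
  also have "\<dots> = ennreal (k powr a) *
      (\<integral>\<^sup>+x\<in>{0<..}. ennreal (x powr (a - 1) * exp (- (k * x))) \<partial>lborel)"
    using k by (subst nn_set_integral_cmult)
      (simp_all add: mult.assoc[symmetric] powr_diff flip: ennreal_mult)
  finally have "ennreal (k powr (- a)) * ennreal (Gamma a) = ennreal (k powr (- a)) * (ennreal (k powr a) *
      (\<integral>\<^sup>+x\<in>{0<..}. ennreal (x powr (a - 1) * exp (- (k * x))) \<partial>lborel))"
    by simp
  also have "\<dots> = (\<integral>\<^sup>+x\<in>{0<..}. ennreal (x powr (a - 1) * exp (- (k * x))) \<partial>lborel)"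
    using k by (simp add: mult.assoc[symmetric] powr_minus flip: ennreal_mult)
  finally show ?thesis
    using a by (simp add: mult.commute flip: ennreal_mult)
qed

text \<open>Kummer's symmetry of the Tricomi function: inserting the gamma integral for
  the power \<open>(\<mu> + c w) powr (-A)\<close> makes the double integral symmetric.\<close>

lemma nn_integral_Tricomi_symmetric:
  fixes A C c \<mu> \<nu> :: real
  assumes "A > 0" "C > 0" "c > 0" "\<mu> > 0" "\<nu> \<ge> 0"
  shows "ennreal (Gamma A) *
      (\<integral>\<^sup>+w\<in>{0<..}. ennreal (w powr (C - 1) * (\<mu> + c * w) powr (- A) * exp (- (\<nu> * w))) \<partial>lborel)
    = ennreal (Gamma C) *
      (\<integral>\<^sup>+u\<in>{0<..}. ennreal (u powr (A - 1) * (\<nu> + c * u) powr (- C) * exp (- (\<mu> * u))) \<partial>lborel)"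
proof -
  let ?f = "\<lambda>w u. ennreal (w powr (C - 1) * exp (- (\<nu> * w)) * (u powr (A - 1) * exp (- ((\<mu> + c * w) * u))))"
  have *: "?f w u = ennreal (w powr (C - 1) * exp (- (\<nu> * w))) *
      ennreal (u powr (A - 1) * exp (- ((\<mu> + c * w) * u)))" for w u
    by (simp add: ennreal_mult)
  \<comment> \<open>The two factorisations agree because \<nu> w + (\<mu> + c w) u = \<mu> u +
    (\<nu> + c u) w.\<close>
  have **: "?f w u = ennreal (u powr (A - 1) * exp (- (\<mu> * u))) *
      ennreal (w powr (C - 1) * exp (- ((\<nu> + c * u) * w)))" for w u
    by (simp flip: ennreal_mult) (simp add: algebra_simps flip: exp_add)
  have g: "(\<integral>\<^sup>+u\<in>{0<..}. ?f w u \<partial>lborel)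
      = ennreal (Gamma A) * ennreal (w powr (C - 1) * (\<mu> + c * w) powr (- A) * exp (- (\<nu> * w)))"
    if "w \<in> {0<..}" for w
  proof -
    have "\<mu> + c * w > 0" using that assms by (simp add: add_pos_pos)
    with assms show ?thesis unfolding *
      by (subst nn_set_integral_cmult, simp, simp, subst nn_integral_Gamma)
        (simp_all add: mult_ac flip: ennreal_mult)
  qed
  have h: "(\<integral>\<^sup>+w\<in>{0<..}. ?f w u \<partial>lborel)
      = ennreal (Gamma C) * ennreal (u powr (A - 1) * (\<nu> + c * u) powr (- C) * exp (- (\<mu> * u)))"
    if "u \<in> {0<..}" for u
  proof -
    \<comment> \<open>Positivity survives \<nu> = 0 since \<open>u > 0\<close>; that boundary case
      yields the Mellin transform later.\<close>
    have "\<nu> + c * u > 0" using that assms by (simp add: add_nonneg_pos)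
    with assms show ?thesis unfolding **
      by (subst nn_set_integral_cmult, simp, simp, subst nn_integral_Gamma)
        (simp_all add: mult_ac flip: ennreal_mult)
  qed
  have "(\<integral>\<^sup>+w\<in>{0<..}. ennreal (Gamma A) * ennreal (w powr (C - 1) * (\<mu> + c * w) powr (- A) * exp (- (\<nu> * w))) \<partial>lborel)
    = (\<integral>\<^sup>+u\<in>{0<..}. ennreal (Gamma C) * ennreal (u powr (A - 1) * (\<nu> + c * u) powr (- C) * exp (- (\<mu> * u))) \<partial>lborel)"
    by (rule nn_set_integral_swap[OF _ _ _ g h]) auto
  then show ?thesis
    by (simp add: nn_set_integral_cmult)
qed

lemma nn_integral_Beta:
  fixes a b :: real
  assumes "a > 0" "b > 0"
  shows "(\<integral>\<^sup>+t\<in>{0<..<1}. ennreal (t powr (a - 1) * (1 - t) powr (b - 1)) \<partial>lborel) = ennreal (Beta a b)"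
  using has_integral_Beta_real[OF assms]
  by (intro nn_integral_has_integral_lebesgue') (auto simp: has_integral_Icc_iff_Ioo)

subsection \<open>Euler's integral for the hypergeometric function\<close>

text \<open>Newton's binomial series at \<open>- y\<close>: the sign (-1)^n in
  \<open>(- A) gchoose n\<close> cancels against that of \<open>(- y) ^ n\<close>.\<close>

lemma pochhammer_binomial_sums:
  fixes A y :: real
  assumes "\<bar>y\<bar> < 1"
  shows "(\<lambda>n. pochhammer A n / fact n * y ^ n) sums (1 - y) powr (- A)"
proof -
  have "(\<lambda>n. ((- A) gchoose n) * (- y) ^ n) sums (1 + (- y)) powr (- A)"
    using assms by (intro gen_binomial_real) simp
  moreover have "((- A) gchoose n) * (- y) ^ n = pochhammer A n / fact n * y ^ n" for n
    by (simp add: gbinomial_pochhammer field_simps flip: power_mult_distrib)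
  ultimately show ?thesis by simp
qed

text \<open>The n-th moment of the Beta weight, in the form that produces the coefficients of the
  hypergeometric series.\<close>

lemma Beta_shift:
  fixes C E :: real
  assumes "C > 0" "E > 0"
  shows "Beta (C + real n) E = Beta C E * pochhammer C n / pochhammer (C + E) n"
proof -
  have *: "pochhammer z n = Gamma (z + real n) / Gamma z" if "z > 0" for z :: real
    using that by (intro pochhammer_Gamma) (auto elim!: nonpos_Ints_cases)
  show ?thesis
    using assms by (simp add: * Beta_def add_ac)
qed

text \<open>Expand \<open>(1 - x * t) powr (- A)\<close> binomially and integrate termwise against
  the Beta weight; the moments supply the remaining Pochhammer quotient. For negative
  \<open>x\<close> the terms alternate in sign, so the interchange rests on absolute
  summability.\<close>

lemma nn_integral_Euler_series:
  fixes A C E x :: real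
  assumes "A > 0" "C > 0" "E > 0" "\<bar>x\<bar> < 1"
  shows "(\<integral>\<^sup>+t\<in>{0<..<1}. ennreal (t powr (C - 1) * (1 - t) powr (E - 1) * (1 - x * t) powr (- A)) \<partial>lborel)
       = ennreal (Beta C E * hyp2F1_series A C (C + E) x)"
proof -
  define h where "h = (\<lambda>t::real. indicator {0<..<1} t * (t powr (C - 1) * (1 - t) powr (E - 1)))"
  have h_nonneg: "h t \<ge> 0" for t by (simp add: h_def)
  have [measurable]: "h \<in> borel_measurable borel" unfolding h_def by simp
  have B: "Beta a b \<ge> 0" if "a > 0" "b > 0" for a b :: real
    using that by (simp add: Beta_def)
  define f where "f = (\<lambda>n t. (pochhammer A n / fact n * x ^ n) * (t ^ n * h t))"
  have poch: "pochhammer A n / fact n \<ge> 0" for n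
    using assms by (simp add: pochhammer_nonneg)
  have bochner: "has_bochner_integral lborel (\<lambda>t. t ^ n * h t) (Beta (C + real n) E)" for n
  proof (rule has_bochner_integral_nn_integral)
    show "AE t in lborel. 0 \<le> t ^ n * h t"
      by (intro AE_I2) (auto simp: h_def split: split_indicator)
    have "(\<integral>\<^sup>+t. ennreal (t ^ n * h t) \<partial>lborel)
        = (\<integral>\<^sup>+t\<in>{0<..<1}. ennreal (t powr (C + real n - 1) * (1 - t) powr (E - 1)) \<partial>lborel)"
      by (intro nn_integral_cong)
        (auto simp: h_def mult_ac powr_realpow powr_diff powr_add split: split_indicator)
    then show "(\<integral>\<^sup>+t. ennreal (t ^ n * h t) \<partial>lborel) = ennreal (Beta (C + real n) E)"
      using assms by (simp add: nn_integral_Beta)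
  qed (use assms B in auto)
  have int_f: "integrable lborel (f n)" for n
    unfolding f_def using bochner by (intro integrable_mult_right) (auto simp: has_bochner_integral_iff)
  have integral_f: "integral\<^sup>L lborel (f n) = pochhammer A n / fact n * x ^ n * Beta (C + real n) E" for n
    unfolding f_def using bochner by (simp add: has_bochner_integral_iff)
  have norm_f: "norm (f n t) = pochhammer A n / fact n * \<bar>x\<bar> ^ n * (t ^ n * h t)" for n t
    using poch[of n] h_nonneg[of t]
    by (auto simp: f_def abs_mult power_abs h_def pochhammer_nonneg assms(1) less_imp_le split: split_indicator)
  have sums_f: "(\<lambda>n. f n t) sums (h t * (1 - x * t) powr (- A))"
    and summable_f: "summable (\<lambda>n. norm (f n t))" for t
  proof -
    \<comment> \<open>Proved for every \<open>y\<close> with modulus below 1, because it is used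
      twice: at \<open>x\<close> for the sum and at \<bar>x\<bar> for the norms.\<close>
    have *: "(\<lambda>n. pochhammer A n / fact n * y ^ n * (t ^ n * h t)) sums (h t * (1 - y * t) powr (- A))"
      if "\<bar>y\<bar> < 1" for y
    proof (cases "t \<in> {0<..<1}")
      case True
      then have "\<bar>y * t\<bar> < 1"
        using that by (simp add: abs_mult) (metis abs_ge_zero mult_strict_mono' mult_1 less_imp_le)
      from sums_mult[OF pochhammer_binomial_sums[OF this, of A], of "h t"] show ?thesis
        by (simp add: power_mult_distrib mult_ac)
    qed (simp add: h_def)
    show "(\<lambda>n. f n t) sums (h t * (1 - x * t) powr (- A))"
      unfolding f_def using assms by (intro *)
    show "summable (\<lambda>n. norm (f n t))"
      unfolding norm_f using assms by (intro sums_summable[OF *]) simp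
  qed
  \<comment> \<open>\<open>Beta\<close> decreases in its first argument, so the norm integrals are
    dominated by \<open>Beta C E\<close> times the binomial series at \<bar>x\<bar>.\<close>
  have summable_int: "summable (\<lambda>n. integral\<^sup>L lborel (\<lambda>t. norm (f n t)))"
  proof (rule summable_comparison_test')
    show "summable (\<lambda>n. pochhammer A n / fact n * \<bar>x\<bar> ^ n * Beta C E)"
      using assms by (intro summable_mult2 sums_summable[OF pochhammer_binomial_sums]) simp
    fix n :: nat
    have "Beta (C + real n) E \<le> Beta C E"
      using assms by (intro Beta_real_mono) auto
    moreover have "integral\<^sup>L lborel (\<lambda>t. norm (f n t)) = pochhammer A n / fact n * \<bar>x\<bar> ^ n * Beta (C + real n) E"
      unfolding norm_f using bochner by (simp add: has_bochner_integral_iff)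
    ultimately show "norm (integral\<^sup>L lborel (\<lambda>t. norm (f n t))) \<le> pochhammer A n / fact n * \<bar>x\<bar> ^ n * Beta C E"
      using poch[of n] B[of "C + real n" E] assms
      by (simp only: real_norm_def abs_of_nonneg zero_le_power abs_ge_zero mult_nonneg_nonneg mult_left_mono)
  qed
  have suminf_f: "(\<Sum>n. f n t) = h t * (1 - x * t) powr (- A)" for t
    using sums_f by (rule sums_unique[symmetric])
  have integrable: "integrable lborel (\<lambda>t. h t * (1 - x * t) powr (- A))"
    using integrable_suminf[OF int_f _ summable_int] summable_f by (simp add: suminf_f)
  have "(\<lambda>n. integral\<^sup>L lborel (f n)) sums integral\<^sup>L lborel (\<lambda>t. h t * (1 - x * t) powr (- A))"
    using sums_integral[OF int_f _ summable_int] summable_f by (simp add: suminf_f)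
  moreover have "integral\<^sup>L lborel (f n)
      = Beta C E * (pochhammer A n * pochhammer C n / (pochhammer (C + E) n * fact n) * x ^ n)" for n
    using assms by (simp add: integral_f Beta_shift mult_ac)
  moreover have "Beta C E \<noteq> 0"
    using assms by (simp add: Beta_def)
  ultimately have "integral\<^sup>L lborel (\<lambda>t. h t * (1 - x * t) powr (- A)) = Beta C E * hyp2F1_series A C (C + E) x"
    unfolding hyp2F1_series_def
    by (simp add: sums_unique[OF sums_mult_D, symmetric])
  moreover have "(\<integral>\<^sup>+t. ennreal (h t * (1 - x * t) powr (- A)) \<partial>lborel)
      = ennreal (integral\<^sup>L lborel (\<lambda>t. h t * (1 - x * t) powr (- A)))"
    using integrable by (rule nn_integral_eq_integral) (simp add: h_nonneg)
  moreover have "(\<integral>\<^sup>+t. ennreal (h t * (1 - x * t) powr (- A)) \<partial>lborel)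
     = (\<integral>\<^sup>+t\<in>{0<..<1}. ennreal (t powr (C - 1) * (1 - t) powr (E - 1) * (1 - x * t) powr (- A)) \<partial>lborel)"
    by (intro nn_integral_cong) (auto simp: h_def split: split_indicator)
  ultimately show ?thesis by simp
qed

text \<open>For \<open>z < 1\<close> this is the series version at \<open>- z\<close>. For
  \<open>z \<ge> 1\<close> the reflection of \<open>t\<close> to \<open>1 - t\<close> rederives
  Pfaff's transformation: the base factors as \<open>(1 + z) * (1 - w * t)\<close>, and
  \<open>C\<close> and \<open>E\<close> trade places, which matches the parameter
  \<open>d - c\<close> in \<open>hyp2F1\<close>.\<close>

lemma nn_integral_Euler_hyp2F1:
  fixes A C E z :: real
  assumes "A > 0" "C > 0" "E > 0" "z > 0"
  shows "(\<integral>\<^sup>+t\<in>{0<..<1}. ennreal (t powr (C - 1) * (1 - t) powr (E - 1) * (1 + z * t) powr (- A)) \<partial>lborel)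
       = ennreal (Beta C E * hyp2F1 A C (C + E) (- z))"
proof (cases "z < 1")
  case True
  then show ?thesis
    using nn_integral_Euler_series[of A C E "- z"] assms by (simp add: hyp2F1_def)
next
  case False
  \<comment> \<open>This is the Pfaff argument \<open>x / (x - 1)\<close> at
    \<open>x = - z\<close>.\<close>
  define w where "w = z / (1 + z)"
  have w: "\<bar>w\<bar> < 1" using assms by (simp add: w_def)
  have "(\<integral>\<^sup>+t\<in>{0<..<1}. ennreal (t powr (C - 1) * (1 - t) powr (E - 1) * (1 + z * t) powr (- A)) \<partial>lborel)
      = (\<integral>\<^sup>+t. ennreal ((1 + (-1) * t) powr (C - 1) * (1 - (1 + (-1) * t)) powr (E - 1)
             * (1 + z * (1 + (-1) * t)) powr (- A)) * indicator {0<..<1} (1 + (-1) * t) \<partial>lborel)"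
    by (subst nn_integral_real_affine[where c = "-1" and t = 1]) auto
  also have "\<dots> = (\<integral>\<^sup>+t\<in>{0<..<1}. ennreal ((1 + z) powr (- A)) *
      ennreal (t powr (E - 1) * (1 - t) powr (C - 1) * (1 - w * t) powr (- A)) \<partial>lborel)"
  proof (intro nn_integral_cong)
    fix t :: real
    have "(1 + z * (1 + (-1) * t)) powr (- A) = (1 + z) powr (- A) * (1 - w * t) powr (- A)" if "0 < t" "t < 1"
    proof -
      have "1 + z * (1 + (-1) * t) = (1 + z) * (1 - w * t)"
        using assms by (simp add: w_def field_simps)
      moreover have "1 - w * t > 0"
        using that w mult_strict_mono[of w 1 t 1] by simp
      ultimately show ?thesis
        using assms by (simp add: powr_mult)
    qed
    then show "ennreal ((1 + (-1) * t) powr (C - 1) * (1 - (1 + (-1) * t)) powr (E - 1)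
             * (1 + z * (1 + (-1) * t)) powr (- A)) * indicator {0<..<1} (1 + (-1) * t)
      = ennreal ((1 + z) powr (- A)) *
      ennreal (t powr (E - 1) * (1 - t) powr (C - 1) * (1 - w * t) powr (- A)) * indicator {0<..<1} t"
      by (auto simp: mult_ac simp flip: ennreal_mult split: split_indicator)
  qed
  also have "\<dots> = ennreal ((1 + z) powr (- A)) * ennreal (Beta E C * hyp2F1_series A E (E + C) w)"
    using assms w by (subst nn_set_integral_cmult) (simp_all add: nn_integral_Euler_series)
  also have "\<dots> = ennreal (Beta C E * hyp2F1 A C (C + E) (- z))"
    using False assms
    by (simp add: hyp2F1_def w_def Beta_commute[of E C] add_ac mult_ac ennreal_mult'[symmetric] minus_divide_left[symmetric] divide_minus_right[symmetric] del: ennreal_mult'')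
  finally show ?thesis .
qed

text \<open>On the series branch the equal parameters cancel and leave the binomial series. On the
  Pfaff branch \<open>d - c = 0\<close>, so only the term with n = 0 survives and the prefactor is
  the answer.\<close>

lemma hyp2F1_eq_powr:
  fixes A C z :: real
  assumes "C > 0" "z > 0"
  shows "hyp2F1 A C C (- z) = (1 + z) powr (- A)"
proof (cases "z < 1")
  case True
  have "pochhammer C n \<noteq> 0" for n
    using assms pochhammer_pos[of C n] by simp
  then show ?thesis
    using True assms pochhammer_binomial_sums[of "- z" A]
    by (simp add: hyp2F1_def hyp2F1_series_def sums_iff)
next
  case False
  have "hyp2F1_series A 0 C y = 1" for y
    unfolding hyp2F1_series_def by (subst suminf_finite[of "{0}"]) (auto simp: pochhammer_0_left)
  then show ?thesis
    using False assms by (simp add: hyp2F1_def)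
qed

text \<open>For \<open>C < D\<close> the last factor of Euler's integrand is at least
  \<open>(1 + z) powr (- A)\<close>, so the integral is bounded below by a positive multiple of
  \<open>Beta C E\<close>. Besides strict positivity of the density, this justifies every later
  passage between products of reals and of \<open>ennreal\<close>.\<close>

lemma hyp2F1_pos:
  fixes A C D z :: real
  assumes "A > 0" "C > 0" "C \<le> D" "z > 0"
  shows "hyp2F1 A C D (- z) > 0"
proof (cases "C = D")
  case True
  with assms show ?thesis by (simp add: hyp2F1_eq_powr)
next
  case False
  define E where "E = D - C"
  have E: "E > 0" "D = C + E" using False assms by (auto simp: E_def)
  have B: "Beta C E > 0"
    using assms E by (simp add: Beta_def)
  have "ennreal ((1 + z) powr (- A) * Beta C E)
      = (\<integral>\<^sup>+t\<in>{0<..<1}. ennreal ((1 + z) powr (- A)) * ennreal (t powr (C - 1) * (1 - t) powr (E - 1)) \<partial>lborel)"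
    using assms E B by (subst nn_set_integral_cmult, simp, simp, subst nn_integral_Beta) (simp_all add: ennreal_mult)
  also have "\<dots> \<le> (\<integral>\<^sup>+t\<in>{0<..<1}. ennreal (t powr (C - 1) * (1 - t) powr (E - 1) * (1 + z * t) powr (- A)) \<partial>lborel)"
  proof (intro nn_integral_mono)
    fix t :: real
    have "(1 + z) powr (- A) \<le> (1 + z * t) powr (- A)" if "0 < t" "t < 1"
      using assms that by (intro powr_mono2') (auto simp: add_pos_pos)
    then show "ennreal ((1 + z) powr (- A)) * ennreal (t powr (C - 1) * (1 - t) powr (E - 1)) * indicator {0<..<1} t
      \<le> ennreal (t powr (C - 1) * (1 - t) powr (E - 1) * (1 + z * t) powr (- A)) * indicator {0<..<1} t"
      by (auto simp: mult_ac intro!: mult_left_mono ennreal_leI simp flip: ennreal_mult split: split_indicator)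
  qed
  also have "\<dots> = ennreal (Beta C E * hyp2F1 A C D (- z))"
    using assms E by (simp add: nn_integral_Euler_hyp2F1)
  finally have "ennreal ((1 + z) powr (- A) * Beta C E) \<le> ennreal (Beta C E * hyp2F1 A C D (- z))" .
  moreover have "(1 + z) powr (- A) * Beta C E > 0"
    using assms B by simp
  \<comment> \<open>\<open>ennreal\<close> sends negative reals to 0, so only the strictly positive
    lower bound determines the sign on the right.\<close>
  ultimately have "Beta C E * hyp2F1 A C D (- z) > 0"
    by (smt (verit) ennreal_le_iff2)
  then show ?thesis using B by (simp add: zero_less_mult_iff)
qed

lemma measurable_hyp2F1 [measurable]: "hyp2F1 a c d \<in> borel_measurable borel"
  unfolding hyp2F1_def[abs_def] hyp2F1_series_def by measurable

subsection \<open>Laplace and Mellin transforms of the hypergeometric function\<close>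

text \<open>The inner substitution \<open>w = r t\<close> turns the Euler integral into a convolution.\<close>

lemma nn_integral_Euler_Laplace:
  fixes A C E c l :: real
  assumes "C > 0" "E > 0" "c > 0" "l > 0"
  shows "(\<integral>\<^sup>+r\<in>{0<..}. ennreal (r powr (C + E - 1) * exp (- (l * r))) *
      (\<integral>\<^sup>+t\<in>{0<..<1}. ennreal (t powr (C - 1) * (1 - t) powr (E - 1) * (1 + c * r * t) powr (- A)) \<partial>lborel) \<partial>lborel)
    = ennreal (Gamma E * l powr (- E)) *
      (\<integral>\<^sup>+w\<in>{0<..}. ennreal (w powr (C - 1) * (1 + c * w) powr (- A) * exp (- (l * w))) \<partial>lborel)"
proof -
  \<comment> \<open>The integrand lives on the triangle 0 < w < r. Its section in \<open>w\<close>
    becomes Euler's integral under \<open>w = r * t\<close>; its section in \<open>r\<close> becomes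
    a gamma integral under \<open>r = w + x\<close>.\<close>
  let ?f = "\<lambda>r w. ennreal (indicator {0<..<r} w * (w powr (C - 1) * (r - w) powr (E - 1) * (1 + c * w) powr (- A) * exp (- (l * r))))"
  have m: "case_prod ?f \<in> borel_measurable (borel \<Otimes>\<^sub>M borel)"
    unfolding greaterThanLessThan_def greaterThan_def lessThan_def by simp
  have g: "(\<integral>\<^sup>+w\<in>{0<..}. ?f r w \<partial>lborel) = ennreal (r powr (C + E - 1) * exp (- (l * r))) *
      (\<integral>\<^sup>+t\<in>{0<..<1}. ennreal (t powr (C - 1) * (1 - t) powr (E - 1) * (1 + c * r * t) powr (- A)) \<partial>lborel)"
    if "r \<in> {0<..}" for r
  proof -
    have r: "r > 0" using that by simp
    have "(\<integral>\<^sup>+w\<in>{0<..}. ?f r w \<partial>lborel)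
        = ennreal r * (\<integral>\<^sup>+t. ?f r (0 + r * t) * indicator {0<..} (0 + r * t) \<partial>lborel)"
      using r by (subst nn_integral_real_affine[where c = r and t = 0]) auto
    also have "(\<integral>\<^sup>+t. ?f r (0 + r * t) * indicator {0<..} (0 + r * t) \<partial>lborel)
       = (\<integral>\<^sup>+t\<in>{0<..<1}. ennreal (r powr (C + E - 2) * exp (- (l * r))) *
           ennreal (t powr (C - 1) * (1 - t) powr (E - 1) * (1 + c * r * t) powr (- A)) \<partial>lborel)"
    proof (intro nn_integral_cong)
      fix t :: real
      have "(r * t) powr (C - 1) * (r - r * t) powr (E - 1)
          = r powr (C + E - 2) * (t powr (C - 1) * (1 - t) powr (E - 1))" if "0 < t" "t < 1"
      proof -
        have "(r - r * t) = r * (1 - t)" by (simp add: algebra_simps)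
        then show ?thesis
          using that r by (simp add: powr_mult powr_add[symmetric] mult_ac)
      qed
      then show "?f r (0 + r * t) * indicator {0<..} (0 + r * t)
        = ennreal (r powr (C + E - 2) * exp (- (l * r))) *
           ennreal (t powr (C - 1) * (1 - t) powr (E - 1) * (1 + c * r * t) powr (- A)) * indicator {0<..<1} t"
        using r by (auto simp: mult_ac zero_less_mult_iff simp flip: ennreal_mult split: split_indicator)
    qed
    also have "ennreal r * \<dots> = ennreal (r * r powr (C + E - 2) * exp (- (l * r))) *
      (\<integral>\<^sup>+t\<in>{0<..<1}. ennreal (t powr (C - 1) * (1 - t) powr (E - 1) * (1 + c * r * t) powr (- A)) \<partial>lborel)"
      using r by (subst nn_set_integral_cmult) (auto simp: mult.assoc ennreal_mult)
    also have "r * r powr (C + E - 2) = r powr (C + E - 1)"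
      using r by (simp add: powr_mult_base)
    finally show ?thesis .
  qed
  have h: "(\<integral>\<^sup>+r\<in>{0<..}. ?f r w \<partial>lborel) = ennreal (Gamma E * l powr (- E)) *
      ennreal (w powr (C - 1) * (1 + c * w) powr (- A) * exp (- (l * w)))"
    if "w \<in> {0<..}" for w
  proof -
    have w: "w > 0" using that by simp
    have "(\<integral>\<^sup>+r\<in>{0<..}. ?f r w \<partial>lborel) = (\<integral>\<^sup>+x. ?f (w + 1 * x) w * indicator {0<..} (w + 1 * x) \<partial>lborel)"
      using m by (subst nn_integral_real_affine[where c = 1 and t = w])
        (auto simp: greaterThanLessThan_def greaterThan_def lessThan_def)
    also have "\<dots> = (\<integral>\<^sup>+x\<in>{0<..}. ennreal (w powr (C - 1) * (1 + c * w) powr (- A) * exp (- (l * w))) *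
         ennreal (x powr (E - 1) * exp (- (l * x))) \<partial>lborel)"
      using w by (intro nn_integral_cong)
        (auto simp: mult_ac distrib_left exp_add exp_diff exp_minus divide_inverse simp flip: ennreal_mult split: split_indicator)
    also have "\<dots> = ennreal (w powr (C - 1) * (1 + c * w) powr (- A) * exp (- (l * w))) *
         ennreal (Gamma E * l powr (- E))"
      using assms by (subst nn_set_integral_cmult) (auto simp: nn_integral_Gamma)
    finally show ?thesis by (simp add: mult.commute)
  qed
  have "(\<integral>\<^sup>+r\<in>{0<..}. ennreal (r powr (C + E - 1) * exp (- (l * r))) *
      (\<integral>\<^sup>+t\<in>{0<..<1}. ennreal (t powr (C - 1) * (1 - t) powr (E - 1) * (1 + c * r * t) powr (- A)) \<partial>lborel) \<partial>lborel)
    = (\<integral>\<^sup>+w\<in>{0<..}. ennreal (Gamma E * l powr (- E)) *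
      ennreal (w powr (C - 1) * (1 + c * w) powr (- A) * exp (- (l * w))) \<partial>lborel)"
    by (rule nn_set_integral_swap[OF m _ _ g h]) auto
  then show ?thesis
    by (simp add: nn_set_integral_cmult)
qed

text \<open>For \<open>C < D\<close>, Euler's integral followed by the convolution formula gives
  \<open>Beta C E\<close> times the left side. For \<open>C = D\<close> the binomial makes both
  integrands coincide and the prefactor is 1.\<close>

lemma nn_integral_Laplace_hyp2F1:
  fixes A C D c l :: real
  assumes "A > 0" "C > 0" "C \<le> D" "c > 0" "l > 0"
  shows "(\<integral>\<^sup>+r\<in>{0<..}. ennreal (r powr (D - 1) * exp (- (l * r)) * hyp2F1 A C D (- (c * r))) \<partial>lborel)
    = ennreal (Gamma D / Gamma C * l powr (C - D)) *
      (\<integral>\<^sup>+w\<in>{0<..}. ennreal (w powr (C - 1) * (1 + c * w) powr (- A) * exp (- (l * w))) \<partial>lborel)"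
    (is "?L = _ * ?R")
proof (cases "C = D")
  case True
  have "?L = ?R"
    using assms True by (intro nn_set_integral_cong) (simp add: hyp2F1_eq_powr mult_ac)
  then show ?thesis
    using True assms by simp
next
  case False
  define E where "E = D - C"
  have E: "E > 0" "D = C + E" using False assms by (auto simp: E_def)
  have B: "Beta C E > 0"
    using assms E by (simp add: Beta_def)
  have "ennreal (Beta C E) * ?L = (\<integral>\<^sup>+r\<in>{0<..}. ennreal (Beta C E) *
      ennreal (r powr (D - 1) * exp (- (l * r)) * hyp2F1 A C D (- (c * r))) \<partial>lborel)"
    by (rule nn_set_integral_cmult[symmetric]) auto
  also have "\<dots> = (\<integral>\<^sup>+r\<in>{0<..}. ennreal (r powr (C + E - 1) * exp (- (l * r))) *
      (\<integral>\<^sup>+t\<in>{0<..<1}. ennreal (t powr (C - 1) * (1 - t) powr (E - 1) * (1 + c * r * t) powr (- A)) \<partial>lborel) \<partial>lborel)"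
  proof (intro nn_set_integral_cong)
    fix r :: real assume "r \<in> {0<..}"
    then have "c * r > 0" using assms by simp
    from nn_integral_Euler_hyp2F1[OF \<open>A > 0\<close> \<open>C > 0\<close> \<open>E > 0\<close> this] hyp2F1_pos[of A C D "c * r"] this
    show "ennreal (Beta C E) * ennreal (r powr (D - 1) * exp (- (l * r)) * hyp2F1 A C D (- (c * r)))
      = ennreal (r powr (C + E - 1) * exp (- (l * r))) *
      (\<integral>\<^sup>+t\<in>{0<..<1}. ennreal (t powr (C - 1) * (1 - t) powr (E - 1) * (1 + c * r * t) powr (- A)) \<partial>lborel)"
      using B assms E by (simp add: mult_ac flip: ennreal_mult)
  qed
  also have "\<dots> = ennreal (Gamma E * l powr (- E)) * ?R"
    using assms E by (intro nn_integral_Euler_Laplace) auto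
  finally have "ennreal (1 / Beta C E) * (ennreal (Beta C E) * ?L)
      = ennreal (1 / Beta C E) * (ennreal (Gamma E * l powr (- E)) * ?R)" by simp
  then have "?L = ennreal (1 / Beta C E * (Gamma E * l powr (- E))) * ?R"
    using B assms E by (simp add: mult.assoc[symmetric] flip: ennreal_mult)
  \<comment> \<open>With \<open>Beta C E = Gamma C * Gamma E / Gamma D\<close> the factor
    \<open>Gamma E\<close> cancels, so the formula takes the same shape as in the case
    \<open>C = D\<close>.\<close>
  also have "1 / Beta C E * (Gamma E * l powr (- E)) = Gamma D / Gamma C * l powr (C - D)"
    using assms E by (simp add: Beta_def)
  finally show ?thesis .
qed

text \<open>Write \<open>r powr (q - 1)\<close> as \<open>r powr (D - 1)\<close> times a negative
  power of \<open>r\<close>, and represent the latter as a gamma integral over \<open>l\<close>.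
  This turns the Mellin transform into an integral of the Laplace transform; a second exchange and
  Kummer's symmetry evaluate it.\<close>

lemma nn_integral_Mellin_hyp2F1:
  fixes A C D c q :: real
  assumes "q > 0" "A > q" "C > q" "C \<le> D" "c > 0"
  shows "(\<integral>\<^sup>+r\<in>{0<..}. ennreal (r powr (q - 1) * hyp2F1 A C D (- (c * r))) \<partial>lborel)
    = ennreal (Gamma D * Gamma (C - q) * Gamma q * Gamma (A - q)
        / (Gamma (D - q) * Gamma C * Gamma A) * c powr (- q))" (is "?M = _")
proof -
  have pos: "A > 0" "C > 0" "D > 0" "D > q" using assms by auto
  have F: "hyp2F1 A C D (- (c * r)) > 0" if "r > 0" for r
    using that assms pos by (intro hyp2F1_pos) auto
  let ?J = "\<lambda>l. \<integral>\<^sup>+w\<in>{0<..}. ennreal (w powr (C - 1) * (1 + c * w) powr (- A) * exp (- (l * w))) \<partial>lborel"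
  let ?k = "Gamma D / Gamma C"
  have k: "?k > 0" using pos by simp
  have "ennreal (Gamma (D - q)) * ?M = (\<integral>\<^sup>+r\<in>{0<..}. ennreal (Gamma (D - q)) *
      ennreal (r powr (q - 1) * hyp2F1 A C D (- (c * r))) \<partial>lborel)"
    by (rule nn_set_integral_cmult[symmetric]) auto
  also have "\<dots> = (\<integral>\<^sup>+l\<in>{0<..}. ennreal (?k * l powr (C - q - 1)) * ?J l \<partial>lborel)"
  proof (rule nn_set_integral_swap[where f = "\<lambda>r l. ennreal (indicator {0<..} r * (l powr (D - q - 1) * exp (- (l * r)) *
            r powr (D - 1) * hyp2F1 A C D (- (c * r))))"])
    fix r :: real assume "r \<in> {0<..}"
    then have r: "r > 0" by simp
    have "(\<integral>\<^sup>+l\<in>{0<..}. ennreal (indicator {0<..} r * (l powr (D - q - 1) * exp (- (l * r)) *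
            r powr (D - 1) * hyp2F1 A C D (- (c * r)))) \<partial>lborel)
        = (\<integral>\<^sup>+l\<in>{0<..}. ennreal (r powr (D - 1) * hyp2F1 A C D (- (c * r))) *
            ennreal (l powr (D - q - 1) * exp (- (r * l))) \<partial>lborel)"
      using r F[OF r] by (intro nn_set_integral_cong) (simp add: mult_ac flip: ennreal_mult)
    also have "\<dots> = ennreal (r powr (D - 1) * hyp2F1 A C D (- (c * r))) *
            ennreal (Gamma (D - q) * r powr (- (D - q)))"
      using r pos by (subst nn_set_integral_cmult, simp, simp, subst nn_integral_Gamma) auto
    also have "\<dots> = ennreal (Gamma (D - q) * (r powr (D - 1) * r powr (- (D - q))) * hyp2F1 A C D (- (c * r)))"
      using F[OF r] pos by (simp add: mult_ac flip: ennreal_mult)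
    also have "r powr (D - 1) * r powr (- (D - q)) = r powr (q - 1)"
      by (simp flip: powr_add)
    finally show "(\<integral>\<^sup>+l\<in>{0<..}. ennreal (indicator {0<..} r * (l powr (D - q - 1) * exp (- (l * r)) *
            r powr (D - 1) * hyp2F1 A C D (- (c * r)))) \<partial>lborel)
       = ennreal (Gamma (D - q)) * ennreal (r powr (q - 1) * hyp2F1 A C D (- (c * r)))"
      using F[OF r] pos by (simp add: mult_ac flip: ennreal_mult)
  next
    fix l :: real assume "l \<in> {0<..}"
    then have l: "l > 0" by simp
    have "(\<integral>\<^sup>+r\<in>{0<..}. ennreal (indicator {0<..} r * (l powr (D - q - 1) * exp (- (l * r)) *
            r powr (D - 1) * hyp2F1 A C D (- (c * r)))) \<partial>lborel)
        = (\<integral>\<^sup>+r\<in>{0<..}. ennreal (l powr (D - q - 1)) *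
            ennreal (r powr (D - 1) * exp (- (l * r)) * hyp2F1 A C D (- (c * r))) \<partial>lborel)"
      using F by (intro nn_set_integral_cong) (simp add: mult_ac less_imp_le flip: ennreal_mult)
    also have "\<dots> = ennreal (l powr (D - q - 1)) * (ennreal (?k * l powr (C - D)) * ?J l)"
      using l assms pos by (subst nn_set_integral_cmult) (auto simp: nn_integral_Laplace_hyp2F1)
    also have "\<dots> = ennreal (?k * (l powr (D - q - 1) * l powr (C - D))) * ?J l"
      using k by (subst ennreal_mult_assoc) (simp_all only: mult.left_commute mult_nonneg_nonneg powr_ge_zero less_imp_le)
    also have "l powr (D - q - 1) * l powr (C - D) = l powr (C - q - 1)"
      by (simp add: algebra_simps flip: powr_add)
    finally show "(\<integral>\<^sup>+r\<in>{0<..}. ennreal (indicator {0<..} r * (l powr (D - q - 1) * exp (- (l * r)) *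
            r powr (D - 1) * hyp2F1 A C D (- (c * r)))) \<partial>lborel) = ennreal (?k * l powr (C - q - 1)) * ?J l" .
  qed auto
  \<comment> \<open>Integrating over \<open>l\<close> first contributes
    \<open>Gamma (C - q) * w powr (q - C)\<close>, which lowers the exponent of \<open>w\<close>
    from \<open>C - 1\<close> to \<open>q - 1\<close>. The trivial factor
    \<open>exp (- (0 * w))\<close> keeps the form of a Tricomi integral with \<nu> = 0.\<close>
  also have "\<dots> = (\<integral>\<^sup>+w\<in>{0<..}. ennreal (?k * Gamma (C - q)) *
      ennreal (w powr (q - 1) * (1 + c * w) powr (- A) * exp (- (0 * w))) \<partial>lborel)"
  proof (rule nn_set_integral_swap[where f = "\<lambda>l w. ennreal (?k * l powr (C - q - 1) * 
            (w powr (C - 1) * (1 + c * w) powr (- A) * exp (- (l * w))))"])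
    fix l :: real
    show "(\<integral>\<^sup>+w\<in>{0<..}. ennreal (?k * l powr (C - q - 1) *
            (w powr (C - 1) * (1 + c * w) powr (- A) * exp (- (l * w)))) \<partial>lborel)
       = ennreal (?k * l powr (C - q - 1)) * ?J l"
      using pos by (subst nn_set_integral_cmult[symmetric]) (simp_all flip: ennreal_mult)
  next
    fix w :: real assume "w \<in> {0<..}"
    then have w: "w > 0" by simp
    have "(\<integral>\<^sup>+l\<in>{0<..}. ennreal (?k * l powr (C - q - 1) *
            (w powr (C - 1) * (1 + c * w) powr (- A) * exp (- (l * w)))) \<partial>lborel)
        = (\<integral>\<^sup>+l\<in>{0<..}. ennreal (?k * (w powr (C - 1) * (1 + c * w) powr (- A))) *
            ennreal (l powr (C - q - 1) * exp (- (w * l))) \<partial>lborel)"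
      using pos by (intro nn_set_integral_cong) (simp add: mult_ac flip: ennreal_mult)
    also have "\<dots> = ennreal (?k * (w powr (C - 1) * (1 + c * w) powr (- A))) *
            ennreal (Gamma (C - q) * w powr (- (C - q)))"
      using w assms by (subst nn_set_integral_cmult, simp, simp, subst nn_integral_Gamma) auto
    also have "\<dots> = ennreal (?k * Gamma (C - q) * ((w powr (C - 1) * w powr (- (C - q))) * (1 + c * w) powr (- A)))"
      using k assms by (simp add: mult_ac flip: ennreal_mult)
    also have "w powr (C - 1) * w powr (- (C - q)) = w powr (q - 1)"
      by (simp flip: powr_add)
    finally show "(\<integral>\<^sup>+l\<in>{0<..}. ennreal (?k * l powr (C - q - 1) *
            (w powr (C - 1) * (1 + c * w) powr (- A) * exp (- (l * w)))) \<partial>lborel)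
        = ennreal (?k * Gamma (C - q)) * ennreal (w powr (q - 1) * (1 + c * w) powr (- A) * exp (- (0 * w)))"
      using pos assms by (simp add: mult.assoc flip: ennreal_mult)
  qed auto
  also have "\<dots> = ennreal (?k * Gamma (C - q)) *
      (\<integral>\<^sup>+w\<in>{0<..}. ennreal (w powr (q - 1) * (1 + c * w) powr (- A) * exp (- (0 * w))) \<partial>lborel)"
    by (rule nn_set_integral_cmult) auto
  finally have M: "ennreal (Gamma (D - q)) * ?M = \<dots>" .
  \<comment> \<open>The other side of Kummer's symmetry with \<mu> = 1, \<nu> = 0 and second
    parameter \<open>q\<close>: the shifted power degenerates to a pure power, leaving a gamma
    integral.\<close>
  have "(\<integral>\<^sup>+u\<in>{0<..}. ennreal (u powr (A - 1) * (0 + c * u) powr (- q) * exp (- (1 * u))) \<partial>lborel)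
     = (\<integral>\<^sup>+u\<in>{0<..}. ennreal (c powr (- q)) * ennreal (u powr (A - q - 1) * exp (- (1 * u))) \<partial>lborel)"
  proof (intro nn_set_integral_cong)
    fix u :: real assume "u \<in> {0<..}"
    then have "u powr (A - 1) * (0 + c * u) powr (- q) = c powr (- q) * u powr (A - q - 1)"
      using assms by (simp add: powr_mult) (simp add: algebra_simps flip: powr_add)
    then show "ennreal (u powr (A - 1) * (0 + c * u) powr (- q) * exp (- (1 * u))) =
        ennreal (c powr (- q)) * ennreal (u powr (A - q - 1) * exp (- (1 * u)))"
      by (simp add: mult.assoc flip: ennreal_mult)
  qed
  also have "\<dots> = ennreal (c powr (- q) * Gamma (A - q))"
    using assms by (subst nn_set_integral_cmult, simp, simp, subst nn_integral_Gamma) (auto simp: ennreal_mult)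
  finally have "ennreal (Gamma A) * (ennreal (Gamma (D - q)) * ?M)
      = ennreal (?k * Gamma (C - q)) * (ennreal (Gamma q) * ennreal (c powr (- q) * Gamma (A - q)))"
    using nn_integral_Tricomi_symmetric[of A q c 1 0] assms pos by (simp add: M mult.left_commute[of "ennreal (Gamma A)"])
  then have "ennreal (1 / (Gamma A * Gamma (D - q))) * (ennreal (Gamma A) * (ennreal (Gamma (D - q)) * ?M))
      = ennreal (1 / (Gamma A * Gamma (D - q))) *
        (ennreal (?k * Gamma (C - q)) * (ennreal (Gamma q) * ennreal (c powr (- q) * Gamma (A - q))))"
    by simp
  moreover have "ennreal (1 / (Gamma A * Gamma (D - q))) * (ennreal (Gamma A) * (ennreal (Gamma (D - q)) * ?M)) = ?M"
    using pos by (simp add: mult.assoc[symmetric] flip: ennreal_mult)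
  ultimately show ?thesis
    using assms pos k by (simp add: mult_ac flip: ennreal_mult)
qed

subsection \<open>The mixing density\<close>

theorem theorem1:
  fixes alpha beta alpha' beta' b p q :: real
  assumes "alpha > 0" "beta > 0" "alpha' > 0" "beta' > 0" "b > 0" "p > 0" "q > 0"
    and "p \<le> alpha'"
  shows "(\<forall>s>0. f_DSD alpha beta alpha' beta' b p q s > 0)
       \<and> ((\<lambda>s. f_DSD alpha beta alpha' beta' b p q s) has_integral 1) {0<..}
       \<and> (\<forall>v>0. ((\<lambda>s. gamma_dens alpha' (beta' / s) v * f_DSD alpha beta alpha' beta' b p q s)
                 has_integral fV alpha beta b p q v) {0<..})"
proof -
  define A C D c where "A = q + alpha" and "C = q + p" and "D = q + alpha'" and "c = b * beta' / beta"
  have pos: "A > 0" "C > 0" "D > 0" "C \<le> D" "c > 0" "A > q" "C > q"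
    using assms by (auto simp: A_def C_def D_def c_def)
  define K where "K = K_DSD alpha beta alpha' beta' b p q"
  have K_eq: "K = c powr q * Gamma C * Gamma alpha' * Gamma A / (Gamma p * Gamma q * Gamma D * Gamma alpha)"
    by (simp add: K_def K_DSD_def A_def C_def D_def c_def Beta_def add.commute)
  have K: "K > 0"
    using pos assms by (simp add: K_eq)
  have f_eq: "f_DSD alpha beta alpha' beta' b p q s = K * s powr (- q - 1) * hyp2F1 A C D (- (c * (1 / s)))" for s
    by (simp add: f_DSD_def K_def A_def C_def D_def c_def mult_ac)
  have F: "hyp2F1 A C D (- (c * r)) > 0" if "r > 0" for r
    using that pos by (intro hyp2F1_pos) auto
  have f_pos: "f_DSD alpha beta alpha' beta' b p q s > 0" if "s > 0" for s
    using that K F[of "1 / s"] by (simp add: f_eq)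
  \<comment> \<open>In the variable \<open>r\<close>, density times Jacobian is \<open>K\<close>
    times the Mellin integrand.\<close>
  have f_recip: "f_DSD alpha beta alpha' beta' b p q (1 / r) / r\<^sup>2
      = K * (r powr (q - 1) * hyp2F1 A C D (- (c * r)))" if "r > 0" for r
    using that powr_reciprocal[OF that, of q, symmetric] by (simp add: f_eq)
  have [measurable]: "f_DSD alpha beta alpha' beta' b p q \<in> borel_measurable borel"
    unfolding f_eq[abs_def] by measurable

  \<comment> \<open>Total mass one\<close>
  have total: "(f_DSD alpha beta alpha' beta' b p q has_integral 1) {0<..}"
  proof (rule has_integral_reciprocal_substitution)
    have "(\<integral>\<^sup>+r\<in>{0<..}. ennreal (f_DSD alpha beta alpha' beta' b p q (1 / r) / r\<^sup>2) \<partial>lborel)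
        = (\<integral>\<^sup>+r\<in>{0<..}. ennreal K * ennreal (r powr (q - 1) * hyp2F1 A C D (- (c * r))) \<partial>lborel)"
      using K F by (intro nn_set_integral_cong) (simp add: f_recip less_imp_le flip: ennreal_mult)
    also have "\<dots> = ennreal K * ennreal (Gamma D * Gamma (C - q) * Gamma q * Gamma (A - q)
        / (Gamma (D - q) * Gamma C * Gamma A) * c powr (- q))"
      using assms pos by (subst nn_set_integral_cmult) (simp_all add: nn_integral_Mellin_hyp2F1)
    also have "\<dots> = ennreal (K * (Gamma D * Gamma p * Gamma q * Gamma alpha
        / (Gamma alpha' * Gamma C * Gamma A) * c powr (- q)))"
      using K assms pos by (simp add: A_def C_def D_def flip: ennreal_mult)
    \<comment> \<open>Since \<open>A - q = alpha\<close>, \<open>C - q = p\<close> and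
      \<open>D - q = alpha'\<close>, the Mellin value is exactly the reciprocal of
      \<open>K\<close>.\<close>
    also have "K * (Gamma D * Gamma p * Gamma q * Gamma alpha
        / (Gamma alpha' * Gamma C * Gamma A) * c powr (- q)) = 1"
      using assms pos by (simp add: K_eq powr_minus field_simps)
    finally show "(\<integral>\<^sup>+r\<in>{0<..}. ennreal (f_DSD alpha beta alpha' beta' b p q (1 / r) / r\<^sup>2) \<partial>lborel) = ennreal 1"
      by simp
  qed (use f_pos in \<open>auto simp: less_imp_le\<close>)

  \<comment> \<open>The mixture equation\<close>
  have mixture: "((\<lambda>s. gamma_dens alpha' (beta' / s) v * f_DSD alpha beta alpha' beta' b p q s)
                 has_integral fV alpha beta b p q v) {0<..}" if v: "v > 0" for v
  proof -
    \<comment> \<open>After \<open>r = 1 / y\<close>, \<open>?I\<close> is the integral behind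
      \<open>fV\<close>; \<open>?J\<close> is the Tricomi integral that the Laplace transform of
      \<open>f_DSD\<close> produces.\<close>
    let ?I = "\<integral>\<^sup>+r\<in>{0<..}. ennreal (r powr (A - 1) * (1 + b * r) powr (- C) * exp (- (beta * v * r))) \<partial>lborel"
    let ?J = "\<integral>\<^sup>+w\<in>{0<..}. ennreal (w powr (C - 1) * (1 + c * w) powr (- A) * exp (- (beta' * v * w))) \<partial>lborel"
    \<comment> \<open>Domination by a gamma integral makes \<open>?I\<close> finite, so that it is
      represented by a real \<open>i\<close>, as \<open>has_integral\<close> demands.\<close>
    have "?I \<le> (\<integral>\<^sup>+r\<in>{0<..}. ennreal (r powr (A - 1) * exp (- (beta * v * r))) \<partial>lborel)"
    proof (intro nn_integral_mono)
      fix r :: real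
      have "(1 + b * r) powr (- C) \<le> 1" if "r > 0"
        using that assms pos powr_mono2'[of "- C" 1 "1 + b * r"] by simp
      then show "ennreal (r powr (A - 1) * (1 + b * r) powr (- C) * exp (- (beta * v * r))) * indicator {0<..} r
        \<le> ennreal (r powr (A - 1) * exp (- (beta * v * r))) * indicator {0<..} r"
        by (auto intro!: ennreal_leI mult_right_mono mult_left_le split: split_indicator)
    qed
    also have "\<dots> = ennreal (Gamma A * (beta * v) powr (- A))"
      using assms v pos by (intro nn_integral_Gamma) auto
    finally obtain i where i: "i \<ge> 0" "?I = ennreal i"
      by (cases ?I) (auto simp: top_unique)

    have J: "ennreal (Gamma A) * ?J = ennreal (Gamma C * ((beta * v) powr A * (beta' * v) powr (- C)) * i)"
    proof -
      \<comment> \<open>As \<open>c = b * beta' / beta\<close>, multiplying \<open>1 + c * w\<close>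
        by \<open>beta * v\<close> gives the base in \<open>?T\<close>. Kummer's symmetry then
        applies with \<mu> = \<open>beta * v\<close>, \<nu> = \<open>beta' * v\<close> and slope
        \<open>b * beta' * v\<close>; on the other side \<open>beta' * v\<close> factors out and
        leaves the integrand of \<open>?I\<close>.\<close>
      let ?T = "\<integral>\<^sup>+w\<in>{0<..}. ennreal (w powr (C - 1) * (beta * v + b * beta' * v * w) powr (- A)
          * exp (- (beta' * v * w))) \<partial>lborel"
      have "?J = (\<integral>\<^sup>+w\<in>{0<..}. ennreal ((beta * v) powr A) * ennreal (w powr (C - 1) *
           (beta * v + b * beta' * v * w) powr (- A) * exp (- (beta' * v * w))) \<partial>lborel)"
      proof (intro nn_set_integral_cong)
        fix w :: real assume "w \<in> {0<..}"
        then have "1 + c * w > 0" using pos by (simp add: add_pos_pos)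
        moreover have "y powr A * (y * x) powr (- A) = x powr (- A)" if "y > 0" "x > 0" for x y :: real
          using that by (simp add: powr_mult powr_minus)
        moreover have "beta * v + b * beta' * v * w = (beta * v) * (1 + c * w)"
          using assms by (simp add: c_def field_simps)
        ultimately have "(beta * v) powr A * (beta * v + b * beta' * v * w) powr (- A) = (1 + c * w) powr (- A)"
          using assms v by simp
        then show "ennreal (w powr (C - 1) * (1 + c * w) powr (- A) * exp (- (beta' * v * w)))
          = ennreal ((beta * v) powr A) * ennreal (w powr (C - 1) *
           (beta * v + b * beta' * v * w) powr (- A) * exp (- (beta' * v * w)))"
          by (simp add: mult.left_commute mult.assoc flip: ennreal_mult)
      qed
      also have "\<dots> = ennreal ((beta * v) powr A) * ?T"
        by (rule nn_set_integral_cmult) auto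
      finally have "ennreal (Gamma A) * ?J = ennreal ((beta * v) powr A) * (ennreal (Gamma A) * ?T)"
        by (simp only: mult.left_commute)
      also have "ennreal (Gamma A) * ?T = ennreal (Gamma C) *
        (\<integral>\<^sup>+u\<in>{0<..}. ennreal (u powr (A - 1) * (beta' * v + b * beta' * v * u) powr (- C) * exp (- (beta * v * u))) \<partial>lborel)"
        using assms v pos by (intro nn_integral_Tricomi_symmetric) auto
      also have "(\<integral>\<^sup>+u\<in>{0<..}. ennreal (u powr (A - 1) * (beta' * v + b * beta' * v * u) powr (- C) * exp (- (beta * v * u))) \<partial>lborel)
        = (\<integral>\<^sup>+u\<in>{0<..}. ennreal ((beta' * v) powr (- C)) *
            ennreal (u powr (A - 1) * (1 + b * u) powr (- C) * exp (- (beta * v * u))) \<partial>lborel)"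
      proof (intro nn_set_integral_cong)
        fix u :: real assume "u \<in> {0<..}"
        then have "1 + b * u > 0" using assms by (simp add: add_pos_pos)
        moreover have "beta' * v + b * beta' * v * u = (beta' * v) * (1 + b * u)"
          by (simp add: algebra_simps)
        ultimately have "(beta' * v + b * beta' * v * u) powr (- C) = (beta' * v) powr (- C) * (1 + b * u) powr (- C)"
          using assms v by (simp add: powr_mult)
        then show "ennreal (u powr (A - 1) * (beta' * v + b * beta' * v * u) powr (- C) * exp (- (beta * v * u)))
          = ennreal ((beta' * v) powr (- C)) *
            ennreal (u powr (A - 1) * (1 + b * u) powr (- C) * exp (- (beta * v * u)))"
          by (simp add: mult.left_commute mult.assoc flip: ennreal_mult)
      qed
      also have "\<dots> = ennreal ((beta' * v) powr (- C)) * ?I"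
        by (rule nn_set_integral_cmult) auto
      finally show ?thesis
        using pos i by (simp add: mult_ac flip: ennreal_mult)
    qed

    \<comment> \<open>\<open>K1\<close>, and \<open>K2\<close> below, collect the factors
      independent of \<open>r\<close> in the two integrands.\<close>
    define K1 where "K1 = beta powr alpha * v powr (alpha - 1) * b powr q / (Gamma alpha * Beta p q)"
    have K1: "K1 > 0"
      using assms v by (simp add: K1_def Beta_def)
    have "((\<lambda>y. gamma_dens alpha (beta / y) v * b2_dens b p q y) has_integral K1 * i) {0<..}"
    proof (rule has_integral_reciprocal_substitution)
      show "(\<lambda>y. gamma_dens alpha (beta / y) v * b2_dens b p q y) \<in> borel_measurable borel"
        unfolding gamma_dens_def b2_dens_def by measurable
      show "gamma_dens alpha (beta / s) v * b2_dens b p q s \<ge> 0" if "s > 0" for s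
        using assms that by (simp add: gamma_dens_def b2_dens_def Beta_def)
      have "gamma_dens alpha (beta / (1 / r)) v * b2_dens b p q (1 / r) / r\<^sup>2
          = K1 * (r powr (A - 1) * (1 + b * r) powr (- C) * exp (- (beta * v * r)))" if r: "r > 0" for r
      proof -
        have "gamma_dens alpha (beta / (1 / r)) v * b2_dens b p q (1 / r) / r\<^sup>2
          = K1 * ((r powr alpha * ((1 / r) powr (- q - 1) / r\<^sup>2)) * (1 + b * r) powr (- C) * exp (- (beta * v * r)))"
          using r v assms minus_add_distrib[of p q, folded diff_conv_add_uminus]
          by (simp add: gamma_dens_def b2_dens_def K1_def C_def powr_mult mult_ac add.commute)
        also have "r powr alpha * ((1 / r) powr (- q - 1) / r\<^sup>2) = r powr (A - 1)"
          unfolding powr_reciprocal[OF r] by (simp add: A_def algebra_simps flip: powr_add)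
        finally show ?thesis .
      qed
      then have "(\<integral>\<^sup>+r\<in>{0<..}. ennreal (gamma_dens alpha (beta / (1 / r)) v * b2_dens b p q (1 / r) / r\<^sup>2) \<partial>lborel)
          = (\<integral>\<^sup>+r\<in>{0<..}. ennreal K1 * ennreal (r powr (A - 1) * (1 + b * r) powr (- C) * exp (- (beta * v * r))) \<partial>lborel)"
        using K1 by (intro nn_set_integral_cong) (simp flip: ennreal_mult)
      also have "\<dots> = ennreal K1 * ennreal i"
        unfolding i(2)[symmetric] by (rule nn_set_integral_cmult) auto
      finally show "(\<integral>\<^sup>+r\<in>{0<..}. ennreal (gamma_dens alpha (beta / (1 / r)) v * b2_dens b p q (1 / r) / r\<^sup>2) \<partial>lborel)
          = ennreal (K1 * i)"
        using K1 i by (simp add: ennreal_mult)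
    qed (use K1 i in simp)
    then have fV: "fV alpha beta b p q v = K1 * i"
      unfolding fV_def by (rule integral_unique)

    define K2 where "K2 = beta' powr alpha' * v powr (alpha' - 1) * K / Gamma alpha'"
    have K2: "K2 > 0"
      using assms v K by (simp add: K2_def)
    show ?thesis
      unfolding fV
    proof (rule has_integral_reciprocal_substitution)
      show "(\<lambda>s. gamma_dens alpha' (beta' / s) v * f_DSD alpha beta alpha' beta' b p q s) \<in> borel_measurable borel"
        unfolding gamma_dens_def by measurable
      show "gamma_dens alpha' (beta' / s) v * f_DSD alpha beta alpha' beta' b p q s \<ge> 0" if "s > 0" for s
        using assms that f_pos[OF that] by (simp add: gamma_dens_def)
      have "gamma_dens alpha' (beta' / (1 / r)) v * f_DSD alpha beta alpha' beta' b p q (1 / r) / r\<^sup>2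
          = K2 * (r powr (D - 1) * exp (- (beta' * v * r)) * hyp2F1 A C D (- (c * r)))" if r: "r > 0" for r
      proof -
        have "gamma_dens alpha' (beta' / (1 / r)) v * f_DSD alpha beta alpha' beta' b p q (1 / r) / r\<^sup>2
            = gamma_dens alpha' (beta' / (1 / r)) v * (f_DSD alpha beta alpha' beta' b p q (1 / r) / r\<^sup>2)"
          by simp
        also have "\<dots> = K2 * ((r powr alpha' * r powr (q - 1)) * exp (- (beta' * v * r)) * hyp2F1 A C D (- (c * r)))"
          unfolding f_recip[OF r] using r v assms by (simp add: gamma_dens_def K2_def powr_mult mult_ac)
        also have "r powr alpha' * r powr (q - 1) = r powr (D - 1)"
          by (simp add: D_def algebra_simps flip: powr_add)
        finally show ?thesis .
      qed
      then have "(\<integral>\<^sup>+r\<in>{0<..}. ennreal (gamma_dens alpha' (beta' / (1 / r)) v * f_DSD alpha beta alpha' beta' b p q (1 / r) / r\<^sup>2) \<partial>lborel)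
          = (\<integral>\<^sup>+r\<in>{0<..}. ennreal K2 * ennreal (r powr (D - 1) * exp (- (beta' * v * r)) * hyp2F1 A C D (- (c * r))) \<partial>lborel)"
        using K2 F by (intro nn_set_integral_cong) (simp add: less_imp_le flip: ennreal_mult)
      also have "\<dots> = ennreal K2 * (ennreal (Gamma D / Gamma C * (beta' * v) powr (C - D)) * ?J)"
        using assms v pos by (subst nn_set_integral_cmult, simp, simp, subst nn_integral_Laplace_hyp2F1) auto
      also have "\<dots> = ennreal (K2 * (Gamma D / Gamma C * (beta' * v) powr (C - D))) * ?J"
        using K2 pos by (intro ennreal_mult_assoc) auto
      \<comment> \<open>Expanding by \<open>Gamma A\<close> creates the product to which
        \<open>J\<close> applies.\<close>
      also have "K2 * (Gamma D / Gamma C * (beta' * v) powr (C - D))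
          = K2 * (Gamma D / Gamma C * (beta' * v) powr (C - D)) / Gamma A * Gamma A"
        using pos by simp
      also have "ennreal \<dots> * ?J = ennreal (K2 * (Gamma D / Gamma C * (beta' * v) powr (C - D)) / Gamma A) *
          (ennreal (Gamma A) * ?J)"
        using K2 pos by (intro ennreal_mult_assoc[symmetric]) auto
      also have "\<dots> = ennreal (K2 * (Gamma D / Gamma C * (beta' * v) powr (C - D)) / Gamma A *
          (Gamma C * ((beta * v) powr A * (beta' * v) powr (- C)) * i))"
        unfolding J using K2 pos i by (intro ennreal_mult[symmetric]) auto
      also have "K2 * (Gamma D / Gamma C * (beta' * v) powr (C - D)) / Gamma A *
          (Gamma C * ((beta * v) powr A * (beta' * v) powr (- C)) * i)
          = K2 * Gamma D / Gamma A * ((beta' * v) powr (C - D) * (beta' * v) powr (- C)) * (beta * v) powr A * i"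
        using pos by simp
      also have "(beta' * v) powr (C - D) * (beta' * v) powr (- C) = (beta' * v) powr (- D)"
        by (simp flip: powr_add)
      \<comment> \<open>The constants match by counting exponents: those of \<open>beta'\<close> sum
        to \<open>alpha' + q - D = 0\<close>, those of \<open>beta\<close> to
        \<open>A - q = alpha\<close>, and those of \<open>v\<close> to
        \<open>alpha' - 1 - D + A = alpha - 1\<close>.\<close>
      also have "K2 * Gamma D / Gamma A * (beta' * v) powr (- D) * (beta * v) powr A = K1"
        using assms v pos
        by (simp add: K1_def K2_def K_eq Beta_def c_def A_def C_def D_def powr_mult powr_divide powr_add powr_diff
            powr_minus field_simps)
      finally show "(\<integral>\<^sup>+r\<in>{0<..}. ennreal (gamma_dens alpha' (beta' / (1 / r)) v * f_DSD alpha beta alpha' beta' b p q (1 / r) / r\<^sup>2) \<partial>lborel)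
          = ennreal (K1 * i)" .
    qed (use K1 i in simp)
  qed
  show ?thesis
    using f_pos total mixture by blast
qed

end
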